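(* Let $A\in\mathbb{C}^{n\times p}$ and $b\in\mathbb{R}^n$. Assume that $b_i\neq 0$ for $i=1,\ldots,n$, that $A$ is injective, and that there is a vector $x\in\mathbb{C}^p$ with $|Ax|=b$ (entrywise modulus). Then the map $$\Phi:\mathbf{H}_p\to\mathbf{H}_n,\qquad \Phi(X)=\mathrm{diag}(b)^{-1}AXA^*\,\mathrm{diag}(b)^{-1}$$ restricts to a bijection between the feasible points $X$ of PhaseLift and the feasible points $U$ of PhaseCutMod.
   Context: $\mathbf{H}_k$ denotes the set of $k\times k$ complex Hermitian matrices; $X\succeq 0$ means $X$ is positive semidefinite; $A^\dagger$ is the Moore-Penrose pseudoinverse of $A$ and $A^{\dagger *}=(A^\dagger)^*$; $\mathrm{diag}(b)$ is the diagonal matrix with diagonal $b$, while for a matrix $U$, $\mathrm{diag}(U)$ is the vector of its diagonal entries. The row vector $a_i^*$ (with $a_i\in\mathbb{C}^p$) is the $i$-th row of $A$. PhaseLift is the semidefinite program: minimize $\mathrm{Tr}(X)$ over $X\in\mathbf{H}_p$ subject to $\mathrm{Tr}(a_ia_i^*X)=b_i^2$ for $i=1,\ldots,n$ and $X\succeq 0$. PhaseCutMod is the semidefinite program: minimize $\mathrm{Tr}(BU)$ over $U\in\mathbf{H}_n$ subject to $\mathrm{Tr}(MU)=0$, $\mathrm{diag}(U)=1$ (all diagonal entries equal to one) and $U\succeq 0$, where $M=\mathrm{diag}(b)(\mathbf{I}-AA^\dagger)\mathrm{diag}(b)$ and $B=\mathrm{diag}(b)A^{\dagger *}A^\dagger\mathrm{diag}(b)$.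 A feasible point of a program is a matrix satisfying all its constraints. *)

theory Defs
  imports "HOL-Analysis.Analysis"
begin

definition cadjoint :: "complex^'p^'n \<Rightarrow> complex^'n^'p" where
  "cadjoint A = (\<chi> i j. cnj (A $ j $ i))"

definition hermitians :: "(complex^'n^'n) set" where
  "hermitians = {X. cadjoint X = X}"

definition psd :: "complex^'n^'n \<Rightarrow> bool" where
  "psd X \<longleftrightarrow> (\<forall>v. (\<Sum>i\<in>UNIV. cnj (v $ i) * (X *v v) $ i) \<in> \<real>\<^sub>\<ge>\<^sub>0)"

definition diag :: "real^'n \<Rightarrow> complex^'n^'n" where
  "diag b = (\<chi> i j. if i = j then complex_of_real (b $ i) else 0)"

definition is_pinv :: "complex^'p^'n \<Rightarrow> complex^'n^'p \<Rightarrow> bool" where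
  "is_pinv A G \<longleftrightarrow> A ** G ** A = A \<and> G ** A ** G = G \<and>
     cadjoint (A ** G) = A ** G \<and> cadjoint (G ** A) = G ** A"

definition pinv :: "complex^'p^'n \<Rightarrow> complex^'n^'p" where
  "pinv A = (THE G. is_pinv A G)"

lemma cadjoint_mult: "cadjoint (A ** B) = cadjoint B ** cadjoint A"
  by (simp add: cadjoint_def matrix_matrix_mult_def vec_eq_iff mult.commute)

lemma is_pinv_unique:
  assumes G: "is_pinv A G" and H: "is_pinv A H"
  shows "G = H"
proof -
  note g = G[unfolded is_pinv_def] and h = H[unfolded is_pinv_def]
  have "A ** G = cadjoint (A ** H ** (A ** G))"
    using g h by (metis matrix_mul_assoc)
  also have "\<dots> = A ** G ** (A ** H)"
    using g h by (simp only: cadjoint_mult[of "A ** H"])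
  also have "\<dots> = A ** H"
    using g by (simp add: matrix_mul_assoc)
  finally have AG: "A ** G = A ** H" .
  have "G ** A = cadjoint (G ** A ** (H ** A))"
    using g h by (metis matrix_mul_assoc)
  also have "\<dots> = H ** A ** (G ** A)"
    using g h by (simp only: cadjoint_mult[of "G ** A"])
  also have "\<dots> = H ** A"
    using g by (metis matrix_mul_assoc)
  finally have GA: "G ** A = H ** A" .
  have "G = G ** A ** G" using g by simp
  also have "\<dots> = H ** (A ** H)" by (simp add: GA AG matrix_mul_assoc[symmetric])
  also have "\<dots> = H" using h by (simp add: matrix_mul_assoc)
  finally show ?thesis .
qed

lemma pinv_eqI: "is_pinv A G \<Longrightarrow> pinv A = G"
  unfolding pinv_def by (blast intro: the_equality is_pinv_unique)

(* The rows of A are the row vectors a_i^*, hence the conjugation. *)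
definition meas_vec :: "complex^'p^'n \<Rightarrow> 'n \<Rightarrow> complex^'p" where
  "meas_vec A i = (\<chi> j. cnj (A $ i $ j))"

(* The rank-one matrix a a^*. *)
definition self_outer :: "complex^'p \<Rightarrow> complex^'p^'p" where
  "self_outer a = (\<chi> j k. a $ j * cnj (a $ k))"

definition phaselift_feasible :: "complex^'p^'n \<Rightarrow> real^'n \<Rightarrow> (complex^'p^'p) set" where
  "phaselift_feasible A b = {X \<in> hermitians.
     (\<forall>i. trace (self_outer (meas_vec A i) ** X) = complex_of_real ((b $ i)\<^sup>2)) \<and> psd X}"

definition M_mat :: "complex^'p^'n \<Rightarrow> real^'n \<Rightarrow> complex^'n^'n" where
  "M_mat A b = diag b ** (mat 1 - A ** pinv A) ** diag b"

definition phasecutmod_feasible :: "complex^'p^'n \<Rightarrow> real^'n \<Rightarrow> (complex^'n^'n) set" where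
  "phasecutmod_feasible A b = {U \<in> hermitians.
     trace (M_mat A b ** U) = 0 \<and> (\<forall>i. U $ i $ i = 1) \<and> psd U}"

definition Phi :: "complex^'p^'n \<Rightarrow> real^'n \<Rightarrow> complex^'p^'p \<Rightarrow> complex^'n^'n" where
  "Phi A b X = matrix_inv (diag b) ** A ** X ** cadjoint A ** matrix_inv (diag b)"

end

theory Submission
  imports Defs
begin

text \<open>For injective \<open>A\<close> the pseudoinverse is \<open>G = (A\<^sup>*A)\<^sup>-\<^sup>1A\<^sup>*\<close>, a left inverse of \<open>A\<close>, so
  \<open>U \<mapsto> G diag(b) U diag(b) G\<^sup>*\<close> is a left inverse of \<open>\<Phi>\<close>. It is also a right inverse on feasible
  points: with \<open>W = diag(b) U diag(b)\<close> and the orthogonal projection \<open>Q = I - AG\<close>, the constraint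
  reads \<open>Tr(QWQ) = 0\<close>, and \<open>W \<succeq> 0\<close> then forces \<open>WQ = 0\<close>, that is, \<open>W = (AG)W(AG)\<close>.\<close>

section \<open>The complex inner product and the adjoint\<close>

definition cinner :: "complex^'n \<Rightarrow> complex^'n \<Rightarrow> complex" where
  "cinner u v = (\<Sum>i\<in>UNIV. cnj (u $ i) * v $ i)"

lemma psd_iff_cinner: "psd X \<longleftrightarrow> (\<forall>v. cinner v (X *v v) \<in> \<real>\<^sub>\<ge>\<^sub>0)"
  by (simp add: psd_def cinner_def)

lemma cinner_add_left: "cinner (u + v) w = cinner u w + cinner v w"
  by (simp add: cinner_def ring_distribs sum.distrib)

lemma cinner_add_right: "cinner u (v + w) = cinner u v + cinner u w"
  by (simp add: cinner_def ring_distribs sum.distrib)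

lemma cinner_scale_left: "cinner (c *s u) v = cnj c * cinner u v"
  by (simp add: cinner_def sum_distrib_left mult_ac)

lemma cinner_scale_right: "cinner u (c *s v) = c * cinner u v"
  by (simp add: cinner_def sum_distrib_left mult_ac)

lemma cinner_axis_left: "cinner (axis i 1) v = v $ i"
proof -
  have "cinner (axis i 1) v = (\<Sum>k\<in>UNIV. if k = i then v $ k else 0)"
    unfolding cinner_def by (rule sum.cong) (auto simp: axis_def)
  then show ?thesis by simp
qed

lemma cinner_self: "cinner v v = of_real (\<Sum>i\<in>UNIV. (cmod (v $ i))\<^sup>2)"
  unfolding cinner_def of_real_sum
  by (rule sum.cong) (simp_all add: complex_norm_square mult.commute del: of_real_power)

lemma cinner_self_eq_0_iff: "cinner v v = 0 \<longleftrightarrow> v = 0"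
  unfolding cinner_self of_real_eq_0_iff
  by (subst sum_nonneg_eq_0_iff) (auto simp: vec_eq_iff)

lemma cinner_cadjoint: "cinner u (X *v v) = cinner (cadjoint X *v u) v"
proof -
  have "cinner u (X *v v) = (\<Sum>i\<in>UNIV. \<Sum>j\<in>UNIV. cnj (u $ i) * (X $ i $ j * v $ j))"
    by (simp add: cinner_def matrix_vector_mult_def sum_distrib_left)
  also have "\<dots> = (\<Sum>j\<in>UNIV. \<Sum>i\<in>UNIV. cnj (u $ i) * (X $ i $ j * v $ j))"
    by (rule sum.swap)
  also have "\<dots> = cinner (cadjoint X *v u) v"
    by (simp add: cinner_def matrix_vector_mult_def sum_distrib_right
        sum_distrib_left cadjoint_def mult_ac)
  finally show ?thesis .
qed

lemma cadjoint_cadjoint [simp]: "cadjoint (cadjoint A) = A"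
  by (simp add: cadjoint_def vec_eq_iff)

lemma cadjoint_mat_1 [simp]: "cadjoint (mat 1) = mat 1"
  by (auto simp: cadjoint_def mat_def vec_eq_iff)

lemma cadjoint_diff: "cadjoint (A - B) = cadjoint A - cadjoint B"
  by (simp add: cadjoint_def vec_eq_iff)

section \<open>Matrix arithmetic, diagonal matrices and (pseudo)inverses\<close>

lemma matrix_mult_diff_left: "(A :: 'a::ring_1^'n^'m) ** (B - C) = A ** B - A ** C"
  by (simp add: matrix_matrix_mult_def vec_eq_iff right_diff_distrib sum_subtractf)

lemma matrix_mult_diff_right: "(A - B :: 'a::ring_1^'n^'m) ** C = A ** C - B ** C"
  by (simp add: matrix_matrix_mult_def vec_eq_iff left_diff_distrib sum_subtractf)

lemma cadjoint_diag [simp]: "cadjoint (diag b) = diag b"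
  by (auto simp: cadjoint_def diag_def vec_eq_iff)

lemma diag_mult_component: "(diag b ** X) $ i $ j = of_real (b $ i) * X $ i $ j"
proof -
  have "(diag b ** X) $ i $ j = (\<Sum>k\<in>UNIV. if i = k then of_real (b $ i) * X $ k $ j else 0)"
    unfolding matrix_matrix_mult_def diag_def vec_lambda_beta by (rule sum.cong) auto
  then show ?thesis by simp
qed

lemma mult_diag_component: "(X ** diag b) $ i $ j = X $ i $ j * of_real (b $ j)"
proof -
  have "(X ** diag b) $ i $ j = (\<Sum>k\<in>UNIV. if k = j then X $ i $ k * of_real (b $ j) else 0)"
    unfolding matrix_matrix_mult_def diag_def vec_lambda_beta by (rule sum.cong) auto
  then show ?thesis by simp
qed

lemma diag_inverse:
  assumes "\<And>i. b $ i \<noteq> 0"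
  shows "diag b ** diag (\<chi> i. inverse (b $ i)) = mat 1"
    and "diag (\<chi> i. inverse (b $ i)) ** diag b = mat 1"
  using assms by (auto simp: vec_eq_iff diag_mult_component) (auto simp: diag_def mat_def)

text \<open>\<open>matrix_inv\<close> is a choice: \<open>B\<close> witnesses that the chosen matrix
  is an inverse, and associativity makes the two agree.\<close>

lemma matrix_inv_eqI:
  fixes A :: "'a::field^'n^'n"
  assumes "A ** B = mat 1" "B ** A = mat 1"
  shows "matrix_inv A = B"
proof -
  have "matrix_inv A ** A = mat 1"
    unfolding matrix_inv_def using assms
      someI[of "\<lambda>C. A ** C = mat 1 \<and> C ** A = mat 1" B] by blast
  then have "matrix_inv A ** A ** B = B" by simp
  then show ?thesis using assms by (simp add: matrix_mul_assoc[symmetric])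
qed

lemma matrix_inv_diag:
  assumes "\<And>i. b $ i \<noteq> 0"
  shows "matrix_inv (diag b) = diag (\<chi> i. inverse (b $ i))"
  using diag_inverse[OF assms] by (rule matrix_inv_eqI)

text \<open>The form of \<open>cadjoint A ** A\<close> at \<open>x\<close> is the squared norm of
  \<open>A *v x\<close>, so injectivity of \<open>A\<close> makes this square matrix
  invertible.\<close>

lemma is_pinv_pinv:
  fixes A :: "complex^'p^'n"
  assumes "inj (\<lambda>x. A *v x)"
  shows "is_pinv A (pinv A)" and "pinv A ** A = mat 1"
proof -
  define N where "N = cadjoint A ** A"
  have "x = 0" if "N *v x = 0" for x
  proof -
    have "cinner (A *v x) (A *v x) = cinner x (N *v x)"
      by (simp add: N_def cinner_cadjoint cadjoint_mult matrix_vector_mul_assoc[symmetric])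
    then have "A *v x = A *v 0"
      using that by (simp add: cinner_def cinner_self_eq_0_iff[unfolded cinner_def])
    then show ?thesis using assms by (blast dest: injD)
  qed
  then obtain K where KN: "K ** N = mat 1"
    using matrix_left_invertible_ker[of N] by blast
  then have NK: "N ** K = mat 1" using matrix_left_right_inverse by blast
  have N: "cadjoint N = N" by (simp add: N_def cadjoint_mult)
  \<comment> \<open>Since \<open>N\<close> is Hermitian, the adjoint of its inverse is again an
    inverse, so \<open>K\<close> is Hermitian too.\<close>
  have "N ** cadjoint K = mat 1"
    using arg_cong[OF KN, of cadjoint] by (simp add: cadjoint_mult N)
  then have K: "cadjoint K = K"
    by (metis KN matrix_mul_assoc matrix_mul_lid matrix_mul_rid)
  define G where "G = K ** cadjoint A"
  have GA: "G ** A = mat 1" using KN by (simp add: G_def N_def matrix_mul_assoc)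
  have "cadjoint (A ** G) = A ** G"
    by (simp add: G_def cadjoint_mult K matrix_mul_assoc)
  \<comment> \<open>With \<open>G ** A = mat 1\<close>, the other three Penrose equations are
    immediate.\<close>
  then have "is_pinv A G"
    by (simp add: is_pinv_def GA matrix_mul_assoc[symmetric])
  with GA show "is_pinv A (pinv A)" "pinv A ** A = mat 1"
    by (simp_all add: pinv_eqI)
qed

section \<open>Congruence, positive semidefinite forms and traces\<close>

lemma hermitians_congruence: "X \<in> hermitians \<Longrightarrow> C ** X ** cadjoint C \<in> hermitians"
  by (simp add: hermitians_def cadjoint_mult matrix_mul_assoc)

lemma psd_congruence:
  assumes "psd X"
  shows "psd (C ** X ** cadjoint C)"
proof -
  have "cinner v ((C ** X ** cadjoint C) *v v) = cinner (cadjoint C *v v) (X *v (cadjoint C *v v))" for v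
    by (simp add: matrix_vector_mul_assoc[symmetric] cinner_cadjoint[of _ C])
  then show ?thesis using assms by (simp add: psd_iff_cinner)
qed

lemma matrix_vector_mult_axis: "(C :: 'a::semiring_1^'n^'m) *v axis j 1 = column j C"
proof -
  have "(\<Sum>k\<in>UNIV. C $ i $ k * axis j 1 $ k) = (\<Sum>k\<in>UNIV. if k = j then C $ i $ k else 0)" for i
    by (rule sum.cong) (auto simp: axis_def)
  then show ?thesis by (simp add: vec_eq_iff matrix_vector_mult_def column_def)
qed

text \<open>Column \<open>j\<close> of \<open>C\<close> is \<open>C\<close> applied to a unit
  vector. This lets a trace be read as a sum of values of the form of \<open>X\<close>.\<close>

lemma cinner_column: "cinner (column j C) (X *v column j C) = (cadjoint C ** X ** C) $ j $ j"
proof -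
  let ?e = "axis j 1"
  have "cinner (C *v ?e) (X *v (C *v ?e)) = cinner ?e ((cadjoint C ** X ** C) *v ?e)"
    by (simp add: cinner_cadjoint[of _ "cadjoint C"] matrix_vector_mul_assoc[symmetric])
  also have "\<dots> = (cadjoint C ** X ** C) $ j $ j"
    by (simp add: cinner_axis_left matrix_vector_mult_axis column_def)
  finally show ?thesis by (simp add: matrix_vector_mult_axis)
qed

text \<open>A zero of a nonnegative form is a minimum, so its first variation vanishes there; in the
  direction \<open>X *v v\<close> that variation is twice the squared norm of
  \<open>X *v v\<close>.\<close>

lemma psd_mult_eq_0:
  assumes H: "X \<in> hermitians" and P: "psd X" and v: "cinner v (X *v v) = 0"
  shows "X *v v = 0"
proof -
  define w where "w = X *v v"
  define s where "s = (\<Sum>i\<in>UNIV. (cmod (w $ i))\<^sup>2)"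
  define q where "q = Re (cinner w (X *v w))"
  have q: "q \<ge> 0" using P by (simp add: psd_iff_cinner q_def complex_nonneg_Reals_iff)
  have wv: "cinner w (X *v v) = of_real s" unfolding s_def w_def by (rule cinner_self)
  \<comment> \<open>Hermitian symmetry makes the second cross term equal to the first.\<close>
  have vw: "cinner v (X *v w) = of_real s"
    using H by (simp add: cinner_cadjoint hermitians_def s_def cinner_self w_def)
  \<comment> \<open>The form on the line \<open>v + t w\<close> is \<open>2ts + t\<^sup>2q\<close>, which is negative for small \<open>t < 0\<close> unless \<open>s = 0\<close>.\<close>
  have ge: "2 * t * s + t\<^sup>2 * q \<ge> 0" for t :: real
  proof -
    let ?u = "v + of_real t *s w"
    have "cinner ?u (X *v ?u) = 2 * of_real t * of_real s + (of_real t)\<^sup>2 * cinner w (X *v w)"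
      by (simp add: matrix_vector_right_distrib vector_scalar_commute cinner_add_left
          cinner_add_right cinner_scale_left cinner_scale_right v vw wv power2_eq_square algebra_simps)
    then have "Re (cinner ?u (X *v ?u)) = 2 * t * s + t\<^sup>2 * q"
      by (simp add: q_def flip: of_real_power of_real_mult)
    then show ?thesis using P by (metis psd_iff_cinner complex_nonneg_Reals_iff)
  qed
  \<comment> \<open>For \<open>s > 0\<close> the point \<open>t = - y\<close> is small enough to
    make the form negative; the \<open>+ 1\<close> covers \<open>q = 0\<close>.\<close>
  define y where "y = s / (q + 1)"
  have s: "s = (q + 1) * y" using q by (simp add: y_def)
  have "2 * (- y) * s + (- y)\<^sup>2 * q = - (y\<^sup>2 * (q + 2))"
    by (simp add: s power2_eq_square algebra_simps)
  then have "y\<^sup>2 * (q + 2) \<le> 0" using ge[of "- y"] by linarith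
  then have "s = 0" using q by (simp add: s mult_le_0_iff)
  then have "cinner w w = 0" by (simp add: cinner_self s_def)
  then show ?thesis by (simp add: cinner_self_eq_0_iff w_def)
qed

text \<open>The trace sums the nonnegative values of the form at the columns of \<open>C\<close>, so
  each value is zero and \<open>X\<close> annihilates each column.\<close>

lemma psd_mult_eq_0_of_trace:
  assumes "X \<in> hermitians" "psd X" and tr: "trace (cadjoint C ** X ** C) = 0"
  shows "X ** C = 0"
proof -
  let ?Y = "cadjoint C ** X ** C"
  have nonneg: "Re (?Y $ j $ j) \<ge> 0" and im: "Im (?Y $ j $ j) = 0" for j
    using assms(2) by (simp_all flip: cinner_column add: psd_iff_cinner complex_nonneg_Reals_iff)
  have "(\<Sum>j\<in>UNIV. Re (?Y $ j $ j)) = 0"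
    using tr by (simp add: trace_def flip: Re_sum)
  then have "Re (?Y $ j $ j) = 0" for j
    using nonneg by (simp add: sum_nonneg_eq_0_iff)
  then have "X *v column j C = 0" for j
    using im by (intro psd_mult_eq_0 assms) (simp add: cinner_column complex_eq_iff)
  then show ?thesis
    by (simp add: vec_eq_iff matrix_vector_mult_def matrix_matrix_mult_def column_def)
qed

text \<open>With \<open>a\<close> for \<open>meas_vec A i\<close>, row \<open>i\<close> of
  \<open>A\<close> is the adjoint of \<open>a\<close>, and both sides are the form of
  \<open>X\<close> at \<open>a\<close>.\<close>

lemma trace_self_outer_meas_vec:
  "trace (self_outer (meas_vec A i) ** X) = (A ** X ** cadjoint A) $ i $ i"
proof -
  have "trace (self_outer (meas_vec A i) ** X)
      = (\<Sum>j\<in>UNIV. \<Sum>k\<in>UNIV. cnj (A $ i $ j) * A $ i $ k * X $ k $ j)"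
    by (simp add: trace_def matrix_matrix_mult_def self_outer_def meas_vec_def)
  also have "\<dots> = (A ** X ** cadjoint A) $ i $ i"
    by (simp add: matrix_matrix_mult_def cadjoint_def sum_distrib_right sum_distrib_left mult_ac)
  finally show ?thesis .
qed

theorem proposition4p2:
  fixes A :: "complex^'p^'n" and b :: "real^'n"
  assumes "\<And>i. b $ i \<noteq> 0"
    and "inj (\<lambda>x. A *v x)"
    and "\<exists>x. \<forall>i. cmod ((A *v x) $ i) = b $ i"
  shows "Phi A b \<in> hermitians \<rightarrow> hermitians \<and>
         bij_betw (Phi A b) (phaselift_feasible A b) (phasecutmod_feasible A b)"
proof
  define D where "D = diag b"
  define E where "E = diag (\<chi> i. inverse (b $ i))"
  define G where "G = pinv A"
  define Q where "Q = mat 1 - A ** G"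
  define Psi where "Psi = (\<lambda>U. G ** D ** U ** D ** cadjoint G)"
  have DE: "D ** E = mat 1" and ED: "E ** D = mat 1"
    unfolding D_def E_def using diag_inverse[OF assms(1)] by auto
  have GA: "G ** A = mat 1" and AG: "cadjoint (A ** G) = A ** G"
    using is_pinv_pinv[OF assms(2)] by (auto simp: G_def is_pinv_def)
  have adj: "cadjoint D = D" "cadjoint E = E" "cadjoint Q = Q"
    by (simp_all add: D_def E_def Q_def cadjoint_diff AG)
  \<comment> \<open>\<open>Q\<close> projects onto the orthogonal complement of the range of
    \<open>A\<close>.\<close>
  have QA: "Q ** A = 0"
    by (simp add: Q_def matrix_mult_diff_right matrix_mul_assoc[symmetric] GA)
  have QQ: "Q ** Q = Q"
  proof -
    have "Q ** Q = Q - Q ** A ** G"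
      by (subst (2) Q_def) (simp add: matrix_mult_diff_left matrix_mul_assoc)
    then show ?thesis by (simp add: QA)
  qed
  \<comment> \<open>Written as congruences, \<open>Phi\<close> and \<open>Psi\<close> preserve
    Hermitian and positive semidefinite matrices.\<close>
  have Phi: "Phi A b X = (E ** A) ** X ** cadjoint (E ** A)" for X
    by (simp add: Phi_def matrix_inv_diag[OF assms(1)] cadjoint_mult adj matrix_mul_assoc flip: E_def)
  have Psi: "Psi U = (G ** D) ** U ** cadjoint (G ** D)" for U
    by (simp add: Psi_def cadjoint_mult adj matrix_mul_assoc)
  have M: "M_mat A b = D ** Q ** D" by (simp add: M_mat_def D_def Q_def G_def)
  show "Phi A b \<in> hermitians \<rightarrow> hermitians"
    by (auto simp: Phi intro: hermitians_congruence)
  have GDEA: "(G ** D) ** (E ** A) = mat 1"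
    by (metis DE GA matrix_mul_assoc matrix_mul_rid)
  have Psi_Phi: "Psi (Phi A b X) = X" for X
  proof -
    have "Psi (Phi A b X) = ((G ** D) ** (E ** A)) ** X ** cadjoint ((G ** D) ** (E ** A))"
      unfolding Psi Phi cadjoint_mult[of "G ** D"] by (simp add: matrix_mul_assoc)
    then show ?thesis by (simp add: GDEA)
  qed
  \<comment> \<open>As \<open>b $ i\<close> is nonzero, a unit diagonal entry of the image is
    exactly one PhaseLift constraint; both inclusions below use this.\<close>
  have diag_Phi: "Phi A b X $ i $ i = trace (self_outer (meas_vec A i) ** X) / of_real ((b $ i)\<^sup>2)" for X i
  proof -
    have "Phi A b X = E ** (A ** X ** cadjoint A) ** E"
      by (simp add: Phi cadjoint_mult adj matrix_mul_assoc)
    then show ?thesis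
      by (simp add: E_def mult_diag_component diag_mult_component trace_self_outer_meas_vec
          power2_eq_square field_simps)
  qed
  have Phi_Psi: "Phi A b (Psi U) = U" if U: "U \<in> phasecutmod_feasible A b" for U
  proof -
    define W where "W = D ** U ** cadjoint D"
    have W: "W \<in> hermitians" "psd W"
      using U unfolding W_def
      by (auto simp: phasecutmod_feasible_def intro: hermitians_congruence psd_congruence)
    \<comment> \<open>Cyclicity of the trace merges the two factors \<open>Q\<close> by idempotence,
      then moves the outer \<open>D\<close> to the front.\<close>
    have "trace (cadjoint Q ** W ** Q) = trace (Q ** W)"
      unfolding adj by (subst trace_mul_sym) (simp add: matrix_mul_assoc QQ)
    also have "\<dots> = trace (M_mat A b ** U)"
      unfolding M W_def adj
      by (subst trace_mul_sym) (metis matrix_mul_assoc trace_mul_sym)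
    also have "\<dots> = 0" using U by (simp add: phasecutmod_feasible_def)
    finally have "W ** Q = 0" by (rule psd_mult_eq_0_of_trace[OF W])
    \<comment> \<open>Expanding \<open>Q\<close> absorbs the projection on the right; adjoints, with
      \<open>W\<close> and \<open>A ** G\<close> Hermitian, give the left side.\<close>
    then have WP: "W ** (A ** G) = W" by (simp add: Q_def matrix_mult_diff_left)
    from arg_cong[OF this, of cadjoint] have PW: "A ** G ** W = W"
      using W by (simp add: cadjoint_mult[of W] AG hermitians_def)
    have "Phi A b (Psi U) = E ** ((A ** G) ** W ** cadjoint (A ** G)) ** E"
      unfolding Phi Psi W_def by (simp add: cadjoint_mult adj matrix_mul_assoc)
    also have "\<dots> = (E ** D) ** U ** (D ** E)"
      unfolding AG PW WP by (simp add: W_def adj matrix_mul_assoc)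
    finally show ?thesis by (simp add: ED DE)
  qed
  show "bij_betw (Phi A b) (phaselift_feasible A b) (phasecutmod_feasible A b)"
  proof (rule bij_betw_byWitness[where f' = Psi])
    show "\<forall>X\<in>phaselift_feasible A b. Psi (Phi A b X) = X" by (simp add: Psi_Phi)
    show "\<forall>U\<in>phasecutmod_feasible A b. Phi A b (Psi U) = U" by (simp add: Phi_Psi)
    show "Phi A b ` phaselift_feasible A b \<subseteq> phasecutmod_feasible A b"
    proof (clarify)
      fix X assume X: "X \<in> phaselift_feasible A b"
      \<comment> \<open>After \<open>D ** E\<close> cancels, \<open>Q\<close> meets
        \<open>A\<close>, so the whole product vanishes and not only its trace.\<close>
      have "M_mat A b ** Phi A b X = D ** (Q ** ((D ** E) ** A)) ** X ** cadjoint (E ** A)"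
        unfolding M Phi by (simp add: matrix_mul_assoc)
      then have "M_mat A b ** Phi A b X = 0" by (simp add: DE QA)
      moreover have "Phi A b X $ i $ i = 1" for i
        using X assms(1)[of i] by (simp add: diag_Phi phaselift_feasible_def)
      moreover have "Phi A b X \<in> hermitians" "psd (Phi A b X)"
        using X unfolding Phi
        by (auto simp: phaselift_feasible_def intro: hermitians_congruence psd_congruence)
      ultimately show "Phi A b X \<in> phasecutmod_feasible A b"
        by (simp add: phasecutmod_feasible_def trace_def)
    qed
    show "Psi ` phasecutmod_feasible A b \<subseteq> phaselift_feasible A b"
    proof (clarify)
      fix U assume U: "U \<in> phasecutmod_feasible A b"
      \<comment> \<open>\<open>Phi A b (Psi U) = U\<close> has unit diagonal, so
        \<open>diag_Phi\<close> at \<open>Psi U\<close> yields the trace.\<close>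
      have "trace (self_outer (meas_vec A i) ** Psi U) = of_real ((b $ i)\<^sup>2)" for i
        using U diag_Phi[of "Psi U" i] assms(1)[of i]
        by (simp add: Phi_Psi phasecutmod_feasible_def)
      moreover have "Psi U \<in> hermitians" "psd (Psi U)"
        using U unfolding Psi
        by (auto simp: phasecutmod_feasible_def intro: hermitians_congruence psd_congruence)
      ultimately show "Psi U \<in> phaselift_feasible A b"
        by (simp add: phaselift_feasible_def)
    qed
  qed
qed

end
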